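(* Let $s\in\mathbb{R}$ and let the true eigenvalue sequence satisfy $\{l_j^\dagger\}_{j\ge1}\in\mathcal{H}^s$. Let $\nu=\mathcal{N}(0,\Lambda)$ be a centered Gaussian measure on $H$ whose covariance operator $\Lambda$ satisfies, for some $c_1\ge 1$ and $\alpha>1/2$, $$c_1^{-1}j^{-2\alpha}\le \langle\varphi_j,\Lambda\varphi_j\rangle\le c_1 j^{-2\alpha}\quad\text{for all sufficiently large } j\in\mathbb{N}.$$ Let the prior on the eigenvalues be $\bigotimes_{j=1}^\infty\mathcal{N}(0,\sigma_j^2)$, where for some $c_2\ge1$ and $p\in\mathbb{R}$, $c_2^{-1}j^{-2p}\le\sigma_j^2\le c_2j^{-2p}$ for all sufficiently large $j\in\mathbb{N}$. Let $P^{D_N}$ be the posterior distribution of the eigenvalue sequence given the data $D_N=(X,Y)$. Fix $\alpha'\in[0,\alpha+1/2)$. If $\min\{\alpha,\alpha'\}+\min\{p-1/2,s\}>0$, then there exists a constant $C>0$, independent of the sample size $N$, such that $$\mathbb{E}^{D_N}\,\mathbb{E}^{\{l_i^{(N)}\}_{i\ge1}\sim P^{D_N}}\sum_{j=1}^\infty j^{-2\alpha'}\bigl|l_j^\dagger-l_j^{(N)}\bigr|^2\le C\,N^{-\frac{\alpha'+\min\{p-1/2,\,s\}}{\alpha+p}}$$ for all sufficiently large $N$, where the first expectation is over the joint law of $D_N$.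
   Context: $H$ is a real, separable, infinite-dimensional Hilbert space with inner product $\langle\cdot,\cdot\rangle$, and $\{\varphi_j\}_{j\in\mathbb{N}}$ is a fixed known orthonormal basis of $H$. For $s\in\mathbb{R}$, $\mathcal{H}^s=\{v:\mathbb{N}\to\mathbb{R}\ :\ \sum_{j\ge1}j^{2s}|v_j|^2<\infty\}$. Truth: $L^\dagger=\sum_j l_j^\dagger\,\varphi_j\otimes\varphi_j$ is a fixed (possibly unbounded) self-adjoint linear operator on $H$, diagonal in $\{\varphi_j\}$, with real eigenvalues $\{l_j^\dagger\}$ and domain $\{h\in H:\sum_j|l_j^\dagger|^2\langle\varphi_j,h\rangle^2<\infty\}$. Data: $\gamma>0$ is fixed; $x_1,\dots,x_N$ are i.i.d. from $\nu$; $g_{jn}=\langle\varphi_j,x_n\rangle$; and one observes $X=(x_1,\dots,x_N)$ and $Y=\{y_{jn}\}$, where $$y_{jn}=g_{jn}\,l_j^\dagger+\gamma\,\xi_{jn},\qquad j\in\mathbb{N},\ n\in\{1,\dots,N\},$$ with $\xi_{jn}$ i.i.d. $\mathcal{N}(0,1)$ independent of $X$. $D_N=(X,Y)$. The covariance operator $\Lambda$ is symmetric, strictly positive-definite and trace-class on $H$, and the prior variances satisfy $\sigma_j^2>0$ for all $j$. Posterior: under the prior $\{l_j\}\sim\bigotimes_j\mathcal{N}(0,\sigma_j^2)$ (independent of $X$ and the noise) and the model $y_{jn}=g_{jn}l_j+\gamma\xi_{jn}$, the posterior is $P^{D_N}=\bigotimes_{j\ge1}\mathcal{N}\bigl(\bar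 l_j^{(N)},(\sigma_j^{(N)})^2\bigr)$ with $$\bar l_j^{(N)}=\frac{N\gamma^{-2}\sigma_j^2\,\frac1N\sum_{n=1}^Ny_{jn}g_{jn}}{1+N\gamma^{-2}\sigma_j^2\,\frac1N\sum_{n=1}^Ng_{jn}^2},\qquad (\sigma_j^{(N)})^2=\frac{\sigma_j^2}{1+N\gamma^{-2}\sigma_j^2\,\frac1N\sum_{n=1}^Ng_{jn}^2}.$$ *)

theory Defs
  imports "HOL-Probability.Probability"
begin

(* Sequences are indexed from 0, so index j here is the index j + 1 = Suc j of the
   mathematical text, and the weight j^r of the text appears as real (Suc j) powr r.
   Sample indices n run over {1..N}. *)

definition orthonormal_basis :: "(nat \<Rightarrow> 'a::real_inner) \<Rightarrow> bool" where
  "orthonormal_basis \<phi> \<longleftrightarrow>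
     (\<forall>i j. \<phi> i \<bullet> \<phi> j = (if i = j then 1 else 0)) \<and> closure (span (range \<phi>)) = UNIV"

definition Hs :: "real \<Rightarrow> (nat \<Rightarrow> real) set" where
  "Hs s = {v. summable (\<lambda>j. real (Suc j) powr (2 * s) * \<bar>v j\<bar>\<^sup>2)}"

definition diag_domain :: "(nat \<Rightarrow> 'a::real_inner) \<Rightarrow> (nat \<Rightarrow> real) \<Rightarrow> 'a set" where
  "diag_domain \<phi> l = {h. summable (\<lambda>j. \<bar>l j\<bar>\<^sup>2 * (\<phi> j \<bullet> h)\<^sup>2)}"

(* An unbounded operator is a function whose values outside its domain are irrelevant. *)
definition diagonal_operator ::
    "(nat \<Rightarrow> 'a::real_inner) \<Rightarrow> (nat \<Rightarrow> real) \<Rightarrow> ('a \<Rightarrow> 'a) \<Rightarrow> bool" where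
  "diagonal_operator \<phi> l L \<longleftrightarrow>
     (\<forall>h\<in>diag_domain \<phi> l. (\<lambda>j. (l j * (\<phi> j \<bullet> h)) *\<^sub>R \<phi> j) sums L h)"

definition symmetric_operator :: "('a::real_inner \<Rightarrow> 'a) \<Rightarrow> bool" where
  "symmetric_operator T \<longleftrightarrow> (\<forall>x y. T x \<bullet> y = x \<bullet> T y)"

(* A is the modulus (T* T)^(1/2): the equation A x \<bullet> A y = T x \<bullet> T y says A^2 = T* T
   for symmetric A.  For a positive symmetric T one has A = T. *)
definition trace_class ::
    "(nat \<Rightarrow> 'a::real_inner) \<Rightarrow> ('a \<Rightarrow> 'a) \<Rightarrow> bool" where
  "trace_class \<phi> T \<longleftrightarrow> bounded_linear T \<and>
     (\<exists>A. bounded_linear A \<and> symmetric_operator A \<and> (\<forall>x. 0 \<le> x \<bullet> A x) \<and>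
          (\<forall>x y. A x \<bullet> A y = T x \<bullet> T y) \<and> summable (\<lambda>j. \<phi> j \<bullet> A (\<phi> j)))"

definition covariance_operator ::
    "(nat \<Rightarrow> 'a::real_inner) \<Rightarrow> ('a \<Rightarrow> 'a) \<Rightarrow> bool" where
  "covariance_operator \<phi> \<Lambda> \<longleftrightarrow>
     symmetric_operator \<Lambda> \<and> (\<forall>h. h \<noteq> 0 \<longrightarrow> 0 < h \<bullet> \<Lambda> h) \<and> trace_class \<phi> \<Lambda>"

(* The second argument is the variance; variance 0 gives a point mass. *)
definition gaussian :: "real \<Rightarrow> real \<Rightarrow> real measure" where
  "gaussian m v =
     (if v = 0 then return borel m else density lborel (\<lambda>x. ennreal (normal_density m (sqrt v) x)))"

definition centered_gaussian_measure ::
    "('a::real_inner \<Rightarrow> 'a) \<Rightarrow> 'a measure \<Rightarrow> bool" where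
  "centered_gaussian_measure \<Lambda> \<nu> \<longleftrightarrow> prob_space \<nu> \<and> sets \<nu> = sets borel \<and>
     (\<forall>h. distr \<nu> borel (\<lambda>x. h \<bullet> x) = gaussian 0 (h \<bullet> \<Lambda> h))"

(* D = (X, Y): the inputs X n and the coordinates Y (j, n) of the noisy outputs. *)
type_synonym 'a data = "(nat \<Rightarrow> 'a) \<times> (nat \<times> nat \<Rightarrow> real)"

definition observe ::
    "(nat \<Rightarrow> 'a::real_inner) \<Rightarrow> real \<Rightarrow> (nat \<Rightarrow> real) \<Rightarrow> nat \<Rightarrow>
     (nat \<Rightarrow> 'a) \<times> (nat \<times> nat \<Rightarrow> real) \<Rightarrow> 'a data" where
  "observe \<phi> \<gamma> l N = (\<lambda>(X, \<xi>).
     (X, \<lambda>(j, n)\<in>UNIV \<times> {1..N}. (\<phi> j \<bullet> X n) * l j + \<gamma> * \<xi> (j, n)))"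

(* Joint law of D_N when the eigenvalue sequence is l.  The product measure on which it is
   built is the joint law of the i.i.d. inputs and the independent i.i.d. noise. *)
definition data_law ::
    "(nat \<Rightarrow> 'a::real_inner) \<Rightarrow> 'a measure \<Rightarrow> real \<Rightarrow> (nat \<Rightarrow> real) \<Rightarrow> nat \<Rightarrow> 'a data measure" where
  "data_law \<phi> \<nu> \<gamma> l N =
     distr (PiM {1..N} (\<lambda>_. \<nu>) \<Otimes>\<^sub>M PiM (UNIV \<times> {1..N}) (\<lambda>_. gaussian 0 1))
           (PiM {1..N} (\<lambda>_. borel) \<Otimes>\<^sub>M PiM (UNIV \<times> {1..N}) (\<lambda>_. borel))
           (observe \<phi> \<gamma> l N)"

definition post_mean ::
    "(nat \<Rightarrow> 'a::real_inner) \<Rightarrow> real \<Rightarrow> (nat \<Rightarrow> real) \<Rightarrow> nat \<Rightarrow> 'a data \<Rightarrow> nat \<Rightarrow> real" where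
  "post_mean \<phi> \<gamma> \<sigma> N = (\<lambda>(X, Y) j.
     (real N * \<gamma> powi (-2) * (\<sigma> j)\<^sup>2 * (1 / real N * (\<Sum>n=1..N. Y (j, n) * (\<phi> j \<bullet> X n)))) /
     (1 + real N * \<gamma> powi (-2) * (\<sigma> j)\<^sup>2 * (1 / real N * (\<Sum>n=1..N. (\<phi> j \<bullet> X n)\<^sup>2))))"

definition post_var ::
    "(nat \<Rightarrow> 'a::real_inner) \<Rightarrow> real \<Rightarrow> (nat \<Rightarrow> real) \<Rightarrow> nat \<Rightarrow> 'a data \<Rightarrow> nat \<Rightarrow> real" where
  "post_var \<phi> \<gamma> \<sigma> N = (\<lambda>(X, Y) j.
     (\<sigma> j)\<^sup>2 /
     (1 + real N * \<gamma> powi (-2) * (\<sigma> j)\<^sup>2 * (1 / real N * (\<Sum>n=1..N. (\<phi> j \<bullet> X n)\<^sup>2))))"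

(* The posterior for the prior given by the product of the N(0, (\<sigma> j)^2).  A conditional
   distribution is only determined almost surely under the marginal law of the data in the
   Bayesian model, and the law of the data for a fixed truth need not be absolutely continuous
   with respect to that marginal.  The explicit conjugate version fixes the choice for every D. *)
definition posterior ::
    "(nat \<Rightarrow> 'a::real_inner) \<Rightarrow> real \<Rightarrow> (nat \<Rightarrow> real) \<Rightarrow> nat \<Rightarrow> 'a data \<Rightarrow> (nat \<Rightarrow> real) measure" where
  "posterior \<phi> \<gamma> \<sigma> N D =
     PiM UNIV (\<lambda>j. gaussian (post_mean \<phi> \<gamma> \<sigma> N D j) (post_var \<phi> \<gamma> \<sigma> N D j))"

(* The Gaussians, the law of the data and the posterior are probability measures; in particular
   the map under which the law of the data is the image measure is measurable. *)
lemma prob_space_gaussian: "v \<ge> 0 \<Longrightarrow> prob_space (gaussian m v)"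
  unfolding gaussian_def by (auto intro!: prob_space_return prob_space_normal_density)

lemma sets_gaussian: "sets (gaussian m v) = sets borel"
  unfolding gaussian_def by auto

lemma observe_measurable:
  fixes \<nu> :: "'a::{real_inner, second_countable_topology} measure"
  assumes s: "sets \<nu> = sets borel"
  shows "observe \<phi> \<gamma> l N \<in> measurable
    (PiM {1..N} (\<lambda>_. \<nu>) \<Otimes>\<^sub>M PiM (UNIV \<times> {1..N}) (\<lambda>_. gaussian 0 1))
    (PiM {1..N} (\<lambda>_. borel) \<Otimes>\<^sub>M PiM (UNIV \<times> {1..N}) (\<lambda>_. borel))"
proof -
  let ?M = "PiM {1..N} (\<lambda>_. borel :: 'a measure) \<Otimes>\<^sub>M
            PiM ((UNIV :: nat set) \<times> {1..N}) (\<lambda>_. borel :: real measure)"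
  have e: "sets (PiM {1..N} (\<lambda>_. \<nu>) \<Otimes>\<^sub>M PiM (UNIV \<times> {1..N}) (\<lambda>_. gaussian 0 1)) = sets ?M"
    by (intro sets_pair_measure_cong sets_PiM_cong) (auto simp: s sets_gaussian)
  have X: "(\<lambda>\<omega>. fst \<omega> n) \<in> borel_measurable ?M" if "n \<in> {1..N}" for n
    by (rule measurable_compose[OF measurable_fst measurable_component_singleton[OF that]])
  have \<xi>: "(\<lambda>\<omega>. snd \<omega> k) \<in> borel_measurable ?M" if "k \<in> UNIV \<times> {1..N}" for k
    by (rule measurable_compose[OF measurable_snd measurable_component_singleton[OF that]])
  have Y: "(\<lambda>\<omega>. \<phi> (fst k) \<bullet> fst \<omega> (snd k) * l (fst k) + \<gamma> * snd \<omega> (fst k, snd k)) \<in> borel_measurable ?M"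
    if "k \<in> UNIV \<times> {1..N}" for k
    using that
    by (intro borel_measurable_add borel_measurable_times borel_measurable_inner
        borel_measurable_const X \<xi>) auto
  show ?thesis
    unfolding measurable_cong_sets[OF e refl] observe_def split_beta'
    by (intro measurable_Pair measurable_fst measurable_restrict Y)
qed

lemma prob_space_data_law:
  fixes \<nu> :: "'a::{real_inner, second_countable_topology} measure"
  assumes "prob_space \<nu>" "sets \<nu> = sets borel"
  shows "prob_space (data_law \<phi> \<nu> \<gamma> l N)"
  unfolding data_law_def
  by (intro prob_space.prob_space_distr observe_measurable assms prob_space_pair prob_space_PiM prob_space_gaussian) auto

lemma post_var_nonneg: "post_var \<phi> \<gamma> \<sigma> N D j \<ge> 0"
proof -
  have "0 \<le> \<gamma> powi (-2)"
    by (simp add: power_int_def)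
  then show ?thesis
    unfolding post_var_def split_beta
    by (intro divide_nonneg_nonneg add_nonneg_nonneg mult_nonneg_nonneg sum_nonneg) auto
qed

lemma prob_space_posterior: "prob_space (posterior \<phi> \<gamma> \<sigma> N D)"
  unfolding posterior_def by (intro prob_space_PiM prob_space_gaussian post_var_nonneg)

end

theory Submission
  imports Defs
begin

text \<open>
  The posterior is a product of Gaussians and the data separate into the coordinates
  \<open>y (j, n) = g (j, n) * l j + \<gamma> * \<xi> (j, n)\<close> with \<open>g (j, n) = \<phi> j \<bullet> X n\<close>, so the risk is a
  sum of one-dimensional Gaussian regression risks with a random design. In coordinate \<open>j\<close> the design
  acts only through its energy \<open>G = (\<Sum>n. (g (j, n))\<^sup>2)\<close>: after averaging over the posterior and
  over the noise, the squared bias, the variance of the posterior mean and the posterior variance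
  together are at most \<open>((l j)\<^sup>2 + 2 * (\<sigma> j)\<^sup>2) / (1 + \<kappa> * G)\<close> with \<open>\<kappa> = (\<sigma> j)\<^sup>2 / \<gamma>\<^sup>2\<close>
  (lemma \<open>noise_averaged_risk_le\<close>).

  The energy \<open>G\<close> is the variance \<open>v j = \<phi> j \<bullet> \<Lambda> (\<phi> j)\<close> times a chi-squared variable with \<open>N\<close>
  degrees of freedom. That variable is at least of order \<open>N\<close> up to an event of exponentially small
  probability, so that \<open>G\<close> may be replaced by a multiple of \<open>N * v j\<close>
  (lemmas \<open>nn_integral_inverse_design_le\<close> and \<open>posterior_risk_le\<close>). Correlations between the
  coordinates of an input do not enter, because the risk is a sum over the coordinates.

  What remains is deterministic. Since \<open>(\<sigma> j)\<^sup>2 * v j\<close> is at least of order \<open>x powr (- \<beta>)\<close> with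
  \<open>x = j + 1\<close> and \<open>\<beta> = 2 * (\<alpha> + p)\<close>, the risk is at most a constant times
  \<open>\<Sum>j. x powr (-2 * \<alpha>') * ((l j)\<^sup>2 + 2 * (\<sigma> j)\<^sup>2) / (1 + N * x powr (- \<beta>))\<close>. For the part with
  \<open>(l j)\<^sup>2\<close>, summability of \<open>x powr (2 * m) * (l j)\<^sup>2\<close> with \<open>m = min (p - 1/2) s\<close> leaves
  a supremum over \<open>j\<close>, which is bounded by interpolation (lemma \<open>powr_damped_le\<close>) and gives the
  stated rate. The part with \<open>(\<sigma> j)\<^sup>2\<close> is a sum of powers that changes its behaviour at
  \<open>x = N powr (1 / \<beta>)\<close> (lemma \<open>sum_powr_damped_le\<close>) and gives the same rate with \<open>p - 1/2\<close> in
  place of \<open>m\<close>. The condition \<open>min \<alpha> \<alpha>' + m > 0\<close> makes the weighted sums converge, and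
  \<open>\<alpha>' < \<alpha> + 1/2\<close> ensures that the damping, not the weight, determines both rates.
\<close>

section \<open>Gaussian integrals\<close>

text \<open>
  Both the posterior and the noise enter the risk only through second moments of this form.
  Writing the square around the mean makes the mixed term vanish.
\<close>

lemma nn_integral_gaussian_affine_square:
  fixes a b m v :: real
  assumes v: "v \<ge> 0"
  shows "(\<integral>\<^sup>+x. ennreal ((a + b * x)\<^sup>2) \<partial>gaussian m v) = ennreal ((a + b * m)\<^sup>2 + b\<^sup>2 * v)"
proof (cases "v = 0")
  case True
  then show ?thesis by (simp add: gaussian_def nn_integral_return)
next
  case False
  then have v0: "v > 0" and s0: "sqrt v > 0" using v by auto
  let ?d = "normal_density m (sqrt v)"
  have m0: "has_bochner_integral lborel ?d 1"
    using normal_moment_even[OF s0, of m 0] by simp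
  have m1: "has_bochner_integral lborel (\<lambda>x. ?d x * (x - m)) 0"
    using normal_moment_odd[OF s0, of m 0] by simp
  have m2: "has_bochner_integral lborel (\<lambda>x. ?d x * (x - m)\<^sup>2) v"
    using normal_moment_even[OF s0, of m 1] v0 by (simp add: power2_eq_square)
  have "has_bochner_integral lborel
      (\<lambda>x. (a + b * m)\<^sup>2 * ?d x + (2 * b * (a + b * m)) * (?d x * (x - m)) + b\<^sup>2 * (?d x * (x - m)\<^sup>2))
      ((a + b * m)\<^sup>2 * 1 + (2 * b * (a + b * m)) * 0 + b\<^sup>2 * v)"
    by (intro has_bochner_integral_add has_bochner_integral_mult_right m0 m1 m2)
  also have "(\<lambda>x. (a + b * m)\<^sup>2 * ?d x + (2 * b * (a + b * m)) * (?d x * (x - m)) + b\<^sup>2 * (?d x * (x - m)\<^sup>2))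
      = (\<lambda>x. ?d x * (a + b * x)\<^sup>2)"
    by (rule ext) algebra
  finally have hb: "has_bochner_integral lborel (\<lambda>x. ?d x * (a + b * x)\<^sup>2) ((a + b * m)\<^sup>2 + b\<^sup>2 * v)"
    by simp
  have "(\<integral>\<^sup>+x. ennreal ((a + b * x)\<^sup>2) \<partial>gaussian m v)
      = (\<integral>\<^sup>+x. ennreal (?d x * (a + b * x)\<^sup>2) \<partial>lborel)"
    using False by (simp add: gaussian_def nn_integral_density ennreal_mult)
  also have "\<dots> = ennreal ((a + b * m)\<^sup>2 + b\<^sup>2 * v)"
    using hb by (intro nn_integral_eq_integral[THEN trans])
      (auto simp: has_bochner_integral_iff)
  finally show ?thesis .
qed

text \<open>
  The Laplace transform of a squared Gaussian at the point \<open>1 / v\<close>: the product of the two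
  exponentials is again a Gaussian density, of variance \<open>v / 3\<close>, up to the factor \<open>1 / sqrt 3\<close>.
  What matters later is that this factor is below 1 and does not depend on \<open>v\<close>.
\<close>

lemma nn_integral_gaussian_exp_square:
  fixes v :: real
  assumes v: "v > 0"
  shows "(\<integral>\<^sup>+x. ennreal (exp (- (x\<^sup>2 / v))) \<partial>gaussian 0 v) = ennreal (1 / sqrt 3)"
proof -
  have s0: "sqrt (v / 3) > 0" using v by simp
  have eq: "normal_density 0 (sqrt v) x * exp (- (x\<^sup>2 / v))
      = (1 / sqrt 3) * normal_density 0 (sqrt (v / 3)) x" for x
  proof -
    have "exp (- (x\<^sup>2 / (2 * v))) * exp (- (x\<^sup>2 / v)) = exp (- (3 * x\<^sup>2 / (2 * v)))"
      using v by (simp add: exp_add[symmetric] field_simps)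
    then show ?thesis
      using v by (simp add: normal_density_def real_sqrt_mult real_sqrt_divide field_simps)
  qed
  have "(\<integral>\<^sup>+x. ennreal (exp (- (x\<^sup>2 / v))) \<partial>gaussian 0 v)
      = (\<integral>\<^sup>+x. ennreal (normal_density 0 (sqrt v) x * exp (- (x\<^sup>2 / v))) \<partial>lborel)"
    using v by (simp add: gaussian_def nn_integral_density ennreal_mult)
  also have "\<dots> = (\<integral>\<^sup>+x. ennreal (1 / sqrt 3) * ennreal (normal_density 0 (sqrt (v / 3)) x) \<partial>lborel)"
    by (simp add: eq flip: ennreal_mult)
  also have "\<dots> = ennreal (1 / sqrt 3) * (\<integral>\<^sup>+x. ennreal (normal_density 0 (sqrt (v / 3)) x) \<partial>lborel)"
    by (simp add: nn_integral_cmult)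
  also have "(\<integral>\<^sup>+x. ennreal (normal_density 0 (sqrt (v / 3)) x) \<partial>lborel) = 1"
    using integral_normal_density[OF s0] by (subst nn_integral_eq_integral) (auto intro: s0 integrable_normal_density)
  finally show ?thesis by simp
qed

text \<open>
  Integrating out one coordinate adds its squared coefficient as a constant, so the formula
  follows by induction on the index set, without a discussion of covariances.
\<close>

lemma nn_integral_PiM_gaussian_affine_square:
  fixes b :: "'i \<Rightarrow> real" and a :: real
  assumes "finite I"
  shows "(\<integral>\<^sup>+x. ennreal ((a + (\<Sum>i\<in>I. b i * x i))\<^sup>2) \<partial>PiM I (\<lambda>_. gaussian 0 1))
    = ennreal (a\<^sup>2 + (\<Sum>i\<in>I. (b i)\<^sup>2))"
  using assms
proof (induction I)
  case empty
  show ?case by (simp add: PiM_empty nn_integral_count_space_finite)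
next
  case (insert i I)
  interpret g: prob_space "gaussian 0 1" by (rule prob_space_gaussian) simp
  interpret product_sigma_finite "\<lambda>_::'i. gaussian 0 1" ..
  interpret I: prob_space "PiM I (\<lambda>_::'i. gaussian 0 1)"
    by (intro prob_space_PiM prob_space_gaussian) simp
  have [measurable_cong]: "sets (gaussian 0 1) = sets borel" by (rule sets_gaussian)
  have "(\<integral>\<^sup>+x. ennreal ((a + (\<Sum>i\<in>insert i I. b i * x i))\<^sup>2) \<partial>PiM (insert i I) (\<lambda>_. gaussian 0 1))
     = (\<integral>\<^sup>+x. (\<integral>\<^sup>+y. ennreal ((a + (\<Sum>k\<in>insert i I. b k * (x(i := y)) k))\<^sup>2) \<partial>gaussian 0 1) \<partial>PiM I (\<lambda>_. gaussian 0 1))"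
    using insert.hyps by (intro product_nn_integral_insert) measurable
  also have "\<dots> = (\<integral>\<^sup>+x. (\<integral>\<^sup>+y. ennreal (((a + (\<Sum>k\<in>I. b k * x k)) + b i * y)\<^sup>2) \<partial>gaussian 0 1) \<partial>PiM I (\<lambda>_. gaussian 0 1))"
  proof -
    have "(\<Sum>k\<in>insert i I. b k * (x(i := y)) k) = (\<Sum>k\<in>I. b k * x k) + b i * y" for x y
      using insert.hyps by (simp add: sum.insert) (intro sum.cong, auto)
    then show ?thesis by (simp add: add.assoc)
  qed
  also have "\<dots> = (\<integral>\<^sup>+x. ennreal ((a + (\<Sum>k\<in>I. b k * x k))\<^sup>2) + ennreal ((b i)\<^sup>2) \<partial>PiM I (\<lambda>_. gaussian 0 1))"
    by (simp add: nn_integral_gaussian_affine_square)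
  also have "\<dots> = ennreal (a\<^sup>2 + (\<Sum>k\<in>insert i I. (b k)\<^sup>2))"
    using insert.hyps
    by (subst nn_integral_add)
      (simp_all add: insert.IH I.emeasure_space_1 sum_nonneg add_ac flip: ennreal_plus)
  finally show ?case .
qed

section \<open>The risk of one coordinate for given inputs\<close>

lemma post_mean_observe:
  assumes "N \<ge> 1"
  shows "post_mean \<phi> \<gamma> \<sigma> N (observe \<phi> \<gamma> l N (X, \<xi>)) j
    = (\<gamma> powi (-2) * (\<sigma> j)\<^sup>2 * (\<Sum>n=1..N. (\<phi> j \<bullet> X n)\<^sup>2) * l j
        + \<gamma> powi (-2) * (\<sigma> j)\<^sup>2 * \<gamma> * (\<Sum>n=1..N. (\<phi> j \<bullet> X n) * \<xi> (j, n)))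
      / (1 + \<gamma> powi (-2) * (\<sigma> j)\<^sup>2 * (\<Sum>n=1..N. (\<phi> j \<bullet> X n)\<^sup>2))"
proof -
  have "(\<Sum>n=1..N. (\<phi> j \<bullet> X n * l j + \<gamma> * \<xi> (j, n)) * (\<phi> j \<bullet> X n))
     = (\<Sum>n=1..N. (\<phi> j \<bullet> X n)\<^sup>2) * l j + \<gamma> * (\<Sum>n=1..N. (\<phi> j \<bullet> X n) * \<xi> (j, n))"
    by (simp add: sum_distrib_left sum_distrib_right sum.distrib[symmetric] power2_eq_square algebra_simps)
  then show ?thesis
    using assms by (simp add: post_mean_def observe_def distrib_left mult.assoc)
qed

lemma post_var_observe:
  assumes "N \<ge> 1"
  shows "post_var \<phi> \<gamma> \<sigma> N (observe \<phi> \<gamma> l N (X, \<xi>)) j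
    = (\<sigma> j)\<^sup>2 / (1 + \<gamma> powi (-2) * (\<sigma> j)\<^sup>2 * (\<Sum>n=1..N. (\<phi> j \<bullet> X n)\<^sup>2))"
  using assms by (simp add: post_var_def observe_def)

lemma nn_integral_posterior_square:
  fixes \<phi> :: "nat \<Rightarrow> 'a::real_inner"
  shows "(\<integral>\<^sup>+l. ennreal ((t - l j)\<^sup>2) \<partial>posterior \<phi> \<gamma> \<sigma> N D)
    = ennreal ((t - post_mean \<phi> \<gamma> \<sigma> N D j)\<^sup>2 + post_var \<phi> \<gamma> \<sigma> N D j)"
proof -
  let ?g = "\<lambda>j. gaussian (post_mean \<phi> \<gamma> \<sigma> N D j) (post_var \<phi> \<gamma> \<sigma> N D j)"
  have c: "distr (PiM UNIV ?g) (?g j) (\<lambda>l. l j) = ?g j"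
    by (intro distr_PiM_component prob_space_gaussian post_var_nonneg) auto
  have [measurable_cong]: "sets (?g i) = sets borel" for i by (rule sets_gaussian)
  have "(\<integral>\<^sup>+l. ennreal ((t - l j)\<^sup>2) \<partial>posterior \<phi> \<gamma> \<sigma> N D)
      = (\<integral>\<^sup>+x. ennreal ((t - x)\<^sup>2) \<partial>distr (PiM UNIV ?g) (?g j) (\<lambda>l. l j))"
    unfolding posterior_def by (subst nn_integral_distr) simp_all
  also have "\<dots> = (\<integral>\<^sup>+x. ennreal ((t + (-1) * x)\<^sup>2) \<partial>?g j)"
    by (simp add: c)
  finally show ?thesis
    by (simp only: nn_integral_gaussian_affine_square[OF post_var_nonneg]) simp
qed

text \<open>
  The \<open>j\<close>-th coordinate of the risk sees only the finitely many noise variables in row \<open>j\<close>;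
  this is the marginal of the infinite product along that row.
\<close>

lemma nn_integral_PiM_pair_slice:
  fixes M :: "'c measure" and j :: 'a and J :: "'b set"
  assumes M: "prob_space M" and f: "f \<in> borel_measurable (PiM J (\<lambda>_. M))"
  shows "(\<integral>\<^sup>+\<xi>. f (\<lambda>n\<in>J. \<xi> (j, n)) \<partial>PiM (UNIV \<times> J) (\<lambda>_. M)) = (\<integral>\<^sup>+x. f x \<partial>PiM J (\<lambda>_. M))"
proof -
  have "distr (PiM (UNIV \<times> J) (\<lambda>_. M)) (PiM J (\<lambda>_. M)) (\<lambda>\<xi>. \<lambda>n\<in>J. \<xi> (j, n)) = PiM J (\<lambda>_. M)"
    using M by (intro distr_PiM_reindex[where f = "\<lambda>n. (j, n)"]) (auto simp: inj_on_def)
  then have "(\<integral>\<^sup>+x. f x \<partial>PiM J (\<lambda>_. M))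
      = (\<integral>\<^sup>+x. f x \<partial>distr (PiM (UNIV \<times> J) (\<lambda>_. M)) (PiM J (\<lambda>_. M)) (\<lambda>\<xi>. \<lambda>n\<in>J. \<xi> (j, n)))"
    by simp
  also have "\<dots> = (\<integral>\<^sup>+\<xi>. f (\<lambda>n\<in>J. \<xi> (j, n)) \<partial>PiM (UNIV \<times> J) (\<lambda>_. M))"
    using f by (subst nn_integral_distr)
      (auto intro!: measurable_restrict measurable_component_singleton)
  finally show ?thesis by simp
qed

text \<open>
  For fixed inputs put \<open>G = (\<Sum>n=1..N. (\<phi> j \<bullet> X n)\<^sup>2)\<close> and \<open>d = 1 + \<kappa> * G\<close>. The bias is
  \<open>l j / d\<close>, and since \<open>d \<ge> 1\<close> its square is at most \<open>(l j)\<^sup>2 / d\<close>. The variance of the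
  posterior mean is at most the posterior variance \<open>(\<sigma> j)\<^sup>2 / d\<close>, because
  \<open>\<kappa> * \<gamma>\<^sup>2 = (\<sigma> j)\<^sup>2\<close> and \<open>\<kappa> * G \<le> d\<close>; this is the origin of the factor 2. Giving up one of
  the two powers of \<open>d\<close> in the bias costs nothing in the final rate.
\<close>

lemma noise_averaged_risk_le:
  fixes \<phi> :: "nat \<Rightarrow> 'a::real_inner" and \<sigma> :: "nat \<Rightarrow> real" and j :: nat
  assumes \<gamma>: "\<gamma> > 0" and N: "N \<ge> 1"
  defines "\<kappa> \<equiv> \<gamma> powi (-2) * (\<sigma> j)\<^sup>2"
  shows "(\<integral>\<^sup>+\<xi>. ennreal ((l j - post_mean \<phi> \<gamma> \<sigma> N (observe \<phi> \<gamma> l N (X, \<xi>)) j)\<^sup>2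
            + post_var \<phi> \<gamma> \<sigma> N (observe \<phi> \<gamma> l N (X, \<xi>)) j)
          \<partial>PiM (UNIV \<times> {1..N}) (\<lambda>_. gaussian 0 1))
    \<le> ennreal (((l j)\<^sup>2 + 2 * (\<sigma> j)\<^sup>2) * (1 / (1 + \<kappa> * (\<Sum>n=1..N. (\<phi> j \<bullet> X n)\<^sup>2))))"
    (is "?I \<le> _")
proof -
  define G where "G = (\<Sum>n=1..N. (\<phi> j \<bullet> X n)\<^sup>2)"
  define d where "d = 1 + \<kappa> * G"
  define a where "a = l j / d"
  define b where "b n = - (\<kappa> * \<gamma> * (\<phi> j \<bullet> X n) / d)" for n
  define V where "V = (\<sigma> j)\<^sup>2 / d"
  let ?P = "PiM {1..N} (\<lambda>_. gaussian 0 1)"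
  have G0: "G \<ge> 0" unfolding G_def by (simp add: sum_nonneg)
  have \<kappa>0: "\<kappa> \<ge> 0" unfolding \<kappa>_def using \<gamma> by simp
  have \<kappa>\<gamma>: "\<kappa> * \<gamma>\<^sup>2 = (\<sigma> j)\<^sup>2"
    using \<gamma> by (simp add: \<kappa>_def power_int_minus field_simps)
  have d1: "d \<ge> 1" using G0 \<kappa>0 unfolding d_def by simp
  have V0: "V \<ge> 0" unfolding V_def using d1 by simp
  have p: "prob_space (gaussian 0 1)" by (rule prob_space_gaussian) simp
  interpret P: prob_space ?P by (intro prob_space_PiM p)
  have [measurable_cong]: "sets (gaussian 0 1) = sets borel" by (rule sets_gaussian)
  \<comment> \<open>The error is an affine function of the noise: bias plus a weighted sum of row \<open>j\<close>.\<close>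
  have risk: "(l j - post_mean \<phi> \<gamma> \<sigma> N (observe \<phi> \<gamma> l N (X, \<xi>)) j)\<^sup>2
            + post_var \<phi> \<gamma> \<sigma> N (observe \<phi> \<gamma> l N (X, \<xi>)) j
      = (a + (\<Sum>n\<in>{1..N}. b n * (\<lambda>n\<in>{1..N}. \<xi> (j, n)) n))\<^sup>2 + V" for \<xi>
  proof -
    have "(\<Sum>n\<in>{1..N}. b n * (\<lambda>n\<in>{1..N}. \<xi> (j, n)) n)
        = - (\<kappa> * \<gamma> * (\<Sum>n=1..N. (\<phi> j \<bullet> X n) * \<xi> (j, n)) / d)"
      by (simp add: b_def sum_negf sum_distrib_left sum_divide_distrib mult.assoc)
    moreover have "l j - post_mean \<phi> \<gamma> \<sigma> N (observe \<phi> \<gamma> l N (X, \<xi>)) j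
        = a - \<kappa> * \<gamma> * (\<Sum>n=1..N. (\<phi> j \<bullet> X n) * \<xi> (j, n)) / d"
      unfolding post_mean_observe[OF N] \<kappa>_def[symmetric] G_def[symmetric] d_def[symmetric] a_def
      using d1 by (simp add: field_simps) (simp add: d_def algebra_simps)
    ultimately show ?thesis
      unfolding post_var_observe[OF N] \<kappa>_def[symmetric] G_def[symmetric] d_def[symmetric] V_def
      by simp
  qed
  have "?I = (\<integral>\<^sup>+x. ennreal ((a + (\<Sum>n\<in>{1..N}. b n * x n))\<^sup>2 + V) \<partial>?P)"
    unfolding risk
    by (rule nn_integral_PiM_pair_slice[OF p, where f = "\<lambda>x. ennreal ((a + (\<Sum>n\<in>{1..N}. b n * x n))\<^sup>2 + V)"]) measurable
  also have "\<dots> = (\<integral>\<^sup>+x. ennreal ((a + (\<Sum>n\<in>{1..N}. b n * x n))\<^sup>2) + ennreal V \<partial>?P)"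
    using V0 by simp
  also have "\<dots> = ennreal (a\<^sup>2 + (\<Sum>n=1..N. (b n)\<^sup>2) + V)"
    using V0 by (subst nn_integral_add)
      (simp_all add: nn_integral_PiM_gaussian_affine_square P.emeasure_space_1 sum_nonneg del: One_nat_def flip: ennreal_plus)
  also have "\<dots> \<le> ennreal (((l j)\<^sup>2 + 2 * (\<sigma> j)\<^sup>2) * (1 / d))"
  proof (rule ennreal_leI)
    have "(\<Sum>n=1..N. (b n)\<^sup>2) = \<kappa>\<^sup>2 * \<gamma>\<^sup>2 * G / d\<^sup>2"
      by (simp add: b_def G_def power_mult_distrib power_divide sum_distrib_left sum_divide_distrib mult.assoc)
    also have "\<dots> = V * (\<kappa> * G / d)"
      unfolding V_def \<kappa>\<gamma>[symmetric] by (simp add: power2_eq_square)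
    also have "\<dots> \<le> V * 1"
      using d1 V0 by (intro mult_left_mono) (auto simp: d_def field_simps)
    finally have B: "(\<Sum>n=1..N. (b n)\<^sup>2) \<le> V" by simp
    have "a\<^sup>2 = (l j)\<^sup>2 / d * (1 / d)"
      by (simp add: a_def power2_eq_square)
    also have "\<dots> \<le> (l j)\<^sup>2 / d * 1"
      using d1 by (intro mult_left_mono) auto
    finally have A: "a\<^sup>2 \<le> (l j)\<^sup>2 / d" by simp
    show "a\<^sup>2 + (\<Sum>n=1..N. (b n)\<^sup>2) + V \<le> ((l j)\<^sup>2 + 2 * (\<sigma> j)\<^sup>2) * (1 / d)"
      using A B by (simp add: V_def add_divide_distrib)
  qed
  finally show ?thesis by (simp add: d_def G_def)
qed

section \<open>Averaging over the random inputs\<close>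

text \<open>
  If \<open>x\<close> reaches the level \<open>y\<close>, the first term suffices, and otherwise the exponential exceeds 1.
  This replaces the split of an expectation along the event \<open>x < y\<close> by a pointwise inequality.
\<close>

lemma inverse_one_plus_le_chernoff:
  fixes x y a :: real
  assumes "a \<ge> 0" "x \<ge> 0" "y \<ge> 0"
  shows "1 / (1 + a * x) \<le> 1 / (1 + a * y) + exp (y - x)"
proof (cases "y \<le> x")
  case True
  then have "1 / (1 + a * x) \<le> 1 / (1 + a * y)"
    using assms by (intro divide_left_mono) (auto intro!: mult_left_mono mult_pos_pos add_pos_nonneg)
  then show ?thesis by (simp add: add_increasing2)
next
  case False
  then have "1 / (1 + a * x) \<le> 1" "1 \<le> exp (y - x)"
    using assms by (auto simp: divide_simps add_nonneg_eq_0_iff)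
  moreover have "0 \<le> 1 / (1 + a * y)" using assms by simp
  ultimately show ?thesis by linarith
qed

text \<open>
  The normalised energy \<open>(\<Sum>n=1..N. (h \<bullet> X n)\<^sup>2) / v\<close> has a chi-squared law with \<open>N\<close> degrees of
  freedom, so it falls below a small multiple of \<open>N\<close> only with exponentially small probability.
  The level \<open>ln 3 / 4 * N\<close> is half of \<open>ln (sqrt 3) * N\<close>: since each input contributes a factor
  \<open>1 / sqrt 3 = exp (- (ln 3 / 2))\<close> to the Laplace transform, the Chernoff bound at this level
  leaves the decay \<open>exp (- (ln 3 / 4 * N))\<close>.
\<close>

lemma nn_integral_inverse_design_le:
  fixes h :: "'a::{real_inner, second_countable_topology}" and \<nu> :: "'a measure"
  assumes \<nu>: "prob_space \<nu>" "sets \<nu> = sets borel"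
    and g: "distr \<nu> borel (\<lambda>x. h \<bullet> x) = gaussian 0 v" and v: "v > 0" and \<kappa>: "\<kappa> \<ge> 0"
  shows "(\<integral>\<^sup>+X. ennreal (1 / (1 + \<kappa> * (\<Sum>n=1..N. (h \<bullet> X n)\<^sup>2))) \<partial>PiM {1..N} (\<lambda>_. \<nu>))
    \<le> ennreal (1 / (1 + \<kappa> * v * (ln 3 / 4 * real N)) + exp (- (ln 3 / 4 * real N)))"
proof -
  interpret \<nu>: prob_space \<nu> by fact
  interpret product_sigma_finite "\<lambda>_::nat. \<nu>" ..
  have [measurable_cong]: "sets \<nu> = sets borel" by fact
  let ?P = "PiM {1..N} (\<lambda>_. \<nu>)"
  interpret P: prob_space ?P by (intro prob_space_PiM \<nu>)
  define y where "y = ln 3 / 4 * real N"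
  have y0: "y \<ge> 0" unfolding y_def by simp
  have one: "(\<integral>\<^sup>+x. ennreal (exp (- ((h \<bullet> x)\<^sup>2 / v))) \<partial>\<nu>) = ennreal (1 / sqrt 3)"
  proof -
    have "(\<integral>\<^sup>+x. ennreal (exp (- ((h \<bullet> x)\<^sup>2 / v))) \<partial>\<nu>)
        = (\<integral>\<^sup>+z. ennreal (exp (- (z\<^sup>2 / v))) \<partial>distr \<nu> borel (\<lambda>x. h \<bullet> x))"
      by (subst nn_integral_distr) measurable
    then show ?thesis by (simp only: g nn_integral_gaussian_exp_square[OF v])
  qed
  have "(\<integral>\<^sup>+X. ennreal (exp (- (\<Sum>n=1..N. (h \<bullet> X n)\<^sup>2 / v))) \<partial>?P)
      = (\<integral>\<^sup>+X. (\<Prod>n\<in>{1..N}. ennreal (exp (- ((h \<bullet> X n)\<^sup>2 / v)))) \<partial>?P)"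
    by (simp add: prod_ennreal exp_sum flip: sum_negf)
  also have "\<dots> = (\<Prod>n\<in>{1..N}. (\<integral>\<^sup>+x. ennreal (exp (- ((h \<bullet> x)\<^sup>2 / v))) \<partial>\<nu>))"
    by (intro product_nn_integral_prod) measurable
  also have "\<dots> = ennreal ((1 / sqrt 3) ^ N)"
    by (simp only: one prod_constant ennreal_power[symmetric]) (simp add: ennreal_power)
  also have "(1 / sqrt 3) ^ N = exp (- 2 * y)"
  proof -
    have "1 / sqrt 3 = exp (- (ln 3 / 2))"
      by (simp add: exp_minus powr_half_sqrt[symmetric] powr_def inverse_eq_divide)
    then show ?thesis
      by (simp add: y_def exp_of_nat_mult[symmetric] mult.commute)
  qed
  finally have E: "(\<integral>\<^sup>+X. ennreal (exp (- (\<Sum>n=1..N. (h \<bullet> X n)\<^sup>2 / v))) \<partial>?P) = ennreal (exp (- 2 * y))" .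
  have "(\<integral>\<^sup>+X. ennreal (1 / (1 + \<kappa> * (\<Sum>n=1..N. (h \<bullet> X n)\<^sup>2))) \<partial>?P)
      \<le> (\<integral>\<^sup>+X. ennreal (1 / (1 + \<kappa> * v * y)) + ennreal (exp y) * ennreal (exp (- (\<Sum>n=1..N. (h \<bullet> X n)\<^sup>2 / v))) \<partial>?P)"
  proof (rule nn_integral_mono)
    fix X
    have "1 / (1 + \<kappa> * v * (\<Sum>n=1..N. (h \<bullet> X n)\<^sup>2 / v))
        \<le> 1 / (1 + \<kappa> * v * y) + exp (y - (\<Sum>n=1..N. (h \<bullet> X n)\<^sup>2 / v))"
      using v \<kappa> y0 by (intro inverse_one_plus_le_chernoff) (auto intro!: sum_nonneg)
    moreover have "v * (\<Sum>n=1..N. (h \<bullet> X n)\<^sup>2 / v) = (\<Sum>n=1..N. (h \<bullet> X n)\<^sup>2)"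
      using v by (simp add: sum_distrib_left)
    ultimately have "1 / (1 + \<kappa> * (\<Sum>n=1..N. (h \<bullet> X n)\<^sup>2))
        \<le> 1 / (1 + \<kappa> * v * y) + exp y * exp (- (\<Sum>n=1..N. (h \<bullet> X n)\<^sup>2 / v))"
      by (simp add: mult.assoc exp_diff exp_minus divide_inverse)
    then show "ennreal (1 / (1 + \<kappa> * (\<Sum>n=1..N. (h \<bullet> X n)\<^sup>2)))
        \<le> ennreal (1 / (1 + \<kappa> * v * y)) + ennreal (exp y) * ennreal (exp (- (\<Sum>n=1..N. (h \<bullet> X n)\<^sup>2 / v)))"
      using v \<kappa> y0 by (simp flip: ennreal_mult ennreal_plus add: ennreal_leI)
  qed
  also have "\<dots> = ennreal (1 / (1 + \<kappa> * v * y)) + ennreal (exp y) * ennreal (exp (- 2 * y))"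
    by (subst nn_integral_add, measurable, subst nn_integral_cmult, measurable)
      (simp add: E P.emeasure_space_1 del: One_nat_def)
  also have "\<dots> = ennreal (1 / (1 + \<kappa> * v * y) + exp (- y))"
    using v \<kappa> y0 by (simp flip: ennreal_mult ennreal_plus exp_add)
  finally show ?thesis unfolding y_def .
qed

text \<open>
  All the summands are nonnegative, so the sum over the coordinates may be taken outside all the
  integrals. In each coordinate the posterior, then the noise, then the inputs are integrated out.
\<close>

lemma posterior_risk_le:
  fixes \<phi> :: "nat \<Rightarrow> 'a::{real_inner, second_countable_topology}" and \<nu> :: "'a measure"
  assumes \<gamma>: "\<gamma> > 0" and N: "N \<ge> 1"
    and \<nu>: "prob_space \<nu>" "sets \<nu> = sets borel"
    and v: "\<And>j. v j > 0" and g: "\<And>j. distr \<nu> borel (\<lambda>x. \<phi> j \<bullet> x) = gaussian 0 (v j)"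
    and w: "\<And>j. w j \<ge> 0"
  shows "(\<integral>\<^sup>+D. (\<integral>\<^sup>+l. (\<Sum>j. ennreal (w j * \<bar>t j - l j\<bar>\<^sup>2)) \<partial>posterior \<phi> \<gamma> \<sigma> N D)
            \<partial>data_law \<phi> \<nu> \<gamma> t N)
    \<le> (\<Sum>j. ennreal (w j * ((t j)\<^sup>2 + 2 * (\<sigma> j)\<^sup>2)
          * (1 / (1 + \<gamma> powi (-2) * (\<sigma> j)\<^sup>2 * v j * (ln 3 / 4 * real N)) + exp (- (ln 3 / 4 * real N)))))"
proof -
  define R where "R j D = (t j - post_mean \<phi> \<gamma> \<sigma> N D j)\<^sup>2 + post_var \<phi> \<gamma> \<sigma> N D j" for j D
  have R0: "R j D \<ge> 0" for j D unfolding R_def by (intro add_nonneg_nonneg post_var_nonneg zero_le_power2)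
  let ?PX = "PiM {1..N} (\<lambda>_. \<nu>)" and ?P\<xi> = "PiM ((UNIV :: nat set) \<times> {1..N}) (\<lambda>_. gaussian 0 1)"
  let ?M = "PiM {1..N} (\<lambda>_. borel :: 'a measure) \<Otimes>\<^sub>M PiM ((UNIV :: nat set) \<times> {1..N}) (\<lambda>_. borel :: real measure)"
  have [measurable_cong]: "sets (gaussian m q) = sets borel" for m q by (rule sets_gaussian)
  have [measurable_cong]: "sets \<nu> = sets borel" by fact
  interpret \<xi>: prob_space ?P\<xi> by (intro prob_space_PiM prob_space_gaussian) simp
  have X [measurable]: "(\<lambda>D. fst D n) \<in> borel_measurable ?M" if "n \<in> {1..N}" for n
    by (rule measurable_compose[OF measurable_fst measurable_component_singleton[OF that]])
  have Y [measurable]: "(\<lambda>D. snd D k) \<in> borel_measurable ?M" if "k \<in> UNIV \<times> {1..N}" for k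
    by (rule measurable_compose[OF measurable_snd measurable_component_singleton[OF that]])
  have g2: "(\<lambda>D. \<Sum>n=1..N. (\<phi> j \<bullet> fst D n)\<^sup>2) \<in> borel_measurable ?M" for j
    by (intro borel_measurable_sum borel_measurable_power borel_measurable_inner borel_measurable_const X)
  have yg: "(\<lambda>D. \<Sum>n=1..N. snd D (j, n) * (\<phi> j \<bullet> fst D n)) \<in> borel_measurable ?M" for j
    by (intro borel_measurable_sum borel_measurable_times borel_measurable_inner borel_measurable_const X Y) auto
  have R [measurable]: "(\<lambda>D. R j D) \<in> borel_measurable ?M" for j
    unfolding R_def post_mean_def post_var_def split_beta
    by (intro borel_measurable_add borel_measurable_diff borel_measurable_power borel_measurable_divide
        borel_measurable_times borel_measurable_const g2 yg)
  have obs [measurable]: "observe \<phi> \<gamma> t N \<in> ?PX \<Otimes>\<^sub>M ?P\<xi> \<rightarrow>\<^sub>M ?M"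
    by (rule observe_measurable) fact
  have inner: "(\<integral>\<^sup>+l. (\<Sum>j. ennreal (w j * \<bar>t j - l j\<bar>\<^sup>2)) \<partial>posterior \<phi> \<gamma> \<sigma> N D)
      = (\<Sum>j. ennreal (w j) * ennreal (R j D))" for D
  proof -
    have "(\<lambda>l. l j) \<in> borel_measurable (posterior \<phi> \<gamma> \<sigma> N D)" for j
      unfolding posterior_def by measurable
    note [measurable] = this
    have "(\<integral>\<^sup>+l. (\<Sum>j. ennreal (w j * \<bar>t j - l j\<bar>\<^sup>2)) \<partial>posterior \<phi> \<gamma> \<sigma> N D)
        = (\<Sum>j. (\<integral>\<^sup>+l. ennreal (w j) * ennreal ((t j - l j)\<^sup>2) \<partial>posterior \<phi> \<gamma> \<sigma> N D))"
      using w by (subst nn_integral_suminf) (measurable, simp add: ennreal_mult)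
    then show ?thesis
      by (simp add: nn_integral_cmult nn_integral_posterior_square R_def)
  qed
  have coord: "(\<integral>\<^sup>+D. ennreal (R j D) \<partial>data_law \<phi> \<nu> \<gamma> t N)
      \<le> ennreal (((t j)\<^sup>2 + 2 * (\<sigma> j)\<^sup>2) *
          (1 / (1 + \<gamma> powi (-2) * (\<sigma> j)\<^sup>2 * v j * (ln 3 / 4 * real N)) + exp (- (ln 3 / 4 * real N))))" for j
  proof -
    define \<kappa> where "\<kappa> = \<gamma> powi (-2) * (\<sigma> j)\<^sup>2"
    have \<kappa>0: "\<kappa> \<ge> 0" unfolding \<kappa>_def using \<gamma> by simp
    define q where "q = (t j)\<^sup>2 + 2 * (\<sigma> j)\<^sup>2"
    have q0: "q \<ge> 0" by (simp add: q_def)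
    have "(\<integral>\<^sup>+D. ennreal (R j D) \<partial>data_law \<phi> \<nu> \<gamma> t N)
        = (\<integral>\<^sup>+\<omega>. ennreal (R j (observe \<phi> \<gamma> t N \<omega>)) \<partial>(?PX \<Otimes>\<^sub>M ?P\<xi>))"
      unfolding data_law_def by (intro nn_integral_distr obs) measurable
    also have "\<dots> = (\<integral>\<^sup>+X. (\<integral>\<^sup>+\<xi>. ennreal (R j (observe \<phi> \<gamma> t N (X, \<xi>))) \<partial>?P\<xi>) \<partial>?PX)"
      by (intro \<xi>.nn_integral_fst[symmetric]) measurable
    also have "\<dots> \<le> (\<integral>\<^sup>+X. ennreal (q * (1 / (1 + \<kappa> * (\<Sum>n=1..N. (\<phi> j \<bullet> X n)\<^sup>2)))) \<partial>?PX)"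
      unfolding R_def q_def \<kappa>_def by (intro nn_integral_mono noise_averaged_risk_le \<gamma> N)
    also have "\<dots> = (\<integral>\<^sup>+X. ennreal q * ennreal (1 / (1 + \<kappa> * (\<Sum>n=1..N. (\<phi> j \<bullet> X n)\<^sup>2))) \<partial>?PX)"
      by (simp only: ennreal_mult'[OF q0])
    also have "\<dots> = ennreal q * (\<integral>\<^sup>+X. ennreal (1 / (1 + \<kappa> * (\<Sum>n=1..N. (\<phi> j \<bullet> X n)\<^sup>2))) \<partial>?PX)"
      by (intro nn_integral_cmult) measurable
    also have "\<dots> \<le> ennreal q * ennreal (1 / (1 + \<kappa> * v j * (ln 3 / 4 * real N)) + exp (- (ln 3 / 4 * real N)))"
      by (intro mult_left_mono nn_integral_inverse_design_le \<nu> g v \<kappa>0) simp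
    finally show ?thesis
      using q0 by (simp add: ennreal_mult' q_def \<kappa>_def)
  qed
  have Rd [measurable]: "(\<lambda>D. R j D) \<in> borel_measurable (data_law \<phi> \<nu> \<gamma> t N)" for j
    using R by (simp add: data_law_def)
  have "(\<integral>\<^sup>+D. (\<integral>\<^sup>+l. (\<Sum>j. ennreal (w j * \<bar>t j - l j\<bar>\<^sup>2)) \<partial>posterior \<phi> \<gamma> \<sigma> N D) \<partial>data_law \<phi> \<nu> \<gamma> t N)
      = (\<Sum>j. ennreal (w j) * (\<integral>\<^sup>+D. ennreal (R j D) \<partial>data_law \<phi> \<nu> \<gamma> t N))"
    unfolding inner by (subst nn_integral_suminf) (measurable, simp add: nn_integral_cmult)
  also have "\<dots> \<le> (\<Sum>j. ennreal (w j) * ennreal (((t j)\<^sup>2 + 2 * (\<sigma> j)\<^sup>2) *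
          (1 / (1 + \<gamma> powi (-2) * (\<sigma> j)\<^sup>2 * v j * (ln 3 / 4 * real N)) + exp (- (ln 3 / 4 * real N)))))"
    by (intro suminf_le mult_left_mono coord) auto
  finally show ?thesis
    using w by (simp add: ennreal_mult'[symmetric] mult.assoc)
qed

section \<open>Power sums with damping\<close>

text \<open>
  Interpolation: with \<open>z = u * x powr (- \<beta>)\<close> and \<open>\<theta> = \<delta> / \<beta>\<close> in the unit interval,
  \<open>z powr \<theta> \<le> 1 + z\<close>, and \<open>z powr \<theta>\<close> cancels the power of \<open>x\<close> exactly. This bounds the bias
  uniformly in the coordinate, without locating the index at which it is largest.
\<close>

lemma powr_damped_le:
  fixes x u \<delta> \<beta> :: real
  assumes x: "x > 0" and u: "u > 0" and \<delta>: "0 \<le> \<delta>" "\<delta> \<le> \<beta>" and \<beta>: "\<beta> > 0"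
  shows "x powr (- \<delta>) / (1 + u * x powr (- \<beta>)) \<le> u powr (- \<delta> / \<beta>)"
proof -
  define \<theta> where "\<theta> = \<delta> / \<beta>"
  have \<theta>: "0 \<le> \<theta>" "\<theta> \<le> 1" "\<beta> * \<theta> = \<delta>" using \<delta> \<beta> by (auto simp: \<theta>_def)
  define z where "z = u * x powr (- \<beta>)"
  have z: "z > 0" using x u by (simp add: z_def)
  have "z powr \<theta> \<le> (1 + z) powr \<theta>" using z \<theta> by (intro powr_mono2) auto
  also have "\<dots> \<le> (1 + z) powr 1" using z \<theta> by (intro powr_mono) auto
  finally have le: "z powr \<theta> \<le> 1 + z" using z by simp
  have "z powr \<theta> = u powr \<theta> * x powr (- \<delta>)"
    using x u \<theta>(3) by (simp add: z_def powr_mult powr_powr)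
  then have "x powr (- \<delta>) = z powr \<theta> * u powr (- \<theta>)"
    using u by (simp add: powr_minus)
  also have "\<dots> \<le> (1 + z) * u powr (- \<theta>)"
    using le by (intro mult_right_mono) auto
  finally show ?thesis
    using z by (simp add: z_def[symmetric] \<theta>_def[symmetric] field_simps)
qed

text \<open>
  A discrete antiderivative of \<open>x powr (e - 1)\<close>, valid for either sign of \<open>e\<close>; it turns the two
  power sums below into telescoping ones.
\<close>

lemma powr_le_powr_difference:
  fixes e :: real
  assumes e: "e \<noteq> 0"
  obtains C where "C > 0" "\<And>x. x \<ge> 1 \<Longrightarrow> x powr (e - 1) \<le> C * (((x + 1) powr e - x powr e) / e)"
proof
  define m where "m = min 1 (2 powr (e - 1))"
  have m: "m > 0" by (simp add: m_def)
  show "1 / m > 0" using m by simp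
  fix x :: real assume x: "x \<ge> 1"
  have "\<exists>z::real. z > x \<and> z < x + 1 \<and> (x + 1) powr e - x powr e = (x + 1 - x) * (e * z powr (e - 1))"
    using x by (intro MVT2) (auto intro!: derivative_eq_intros simp: powr_diff field_simps)
  then obtain z where z: "x < z" "z < x + 1" "(x + 1) powr e - x powr e = e * z powr (e - 1)"
    by auto
  have zx: "1 \<le> z / x" "z / x \<le> 2" using x z by (auto simp: field_simps)
  have "m \<le> (z / x) powr (e - 1)"
  proof (cases "e \<ge> 1")
    case True
    then have "1 powr (e - 1) \<le> (z / x) powr (e - 1)" using zx by (intro powr_mono2) auto
    then show ?thesis by (simp add: m_def)
  next
    case False
    then have "2 powr (e - 1) \<le> (z / x) powr (e - 1)" using zx by (intro powr_mono2') auto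
    then show ?thesis by (simp add: m_def)
  qed
  then have "x powr (e - 1) * m \<le> x powr (e - 1) * (z / x) powr (e - 1)"
    by (intro mult_left_mono) auto
  also have "\<dots> = z powr (e - 1)"
    using x z by (simp add: powr_divide)
  finally show "x powr (e - 1) \<le> 1 / m * (((x + 1) powr e - x powr e) / e)"
    using m e z(3) by (simp add: field_simps)
qed

lemma sum_powr_le:
  fixes e :: real
  assumes e: "e > 0"
  obtains C where "C > 0" "\<And>n. (\<Sum>j<n. real (Suc j) powr (e - 1)) \<le> C * real (Suc n) powr e"
proof -
  obtain C where C: "C > 0" "\<And>x. x \<ge> 1 \<Longrightarrow> x powr (e - 1) \<le> C * (((x + 1) powr e - x powr e) / e)"
    using powr_le_powr_difference[of e] e by auto
  have "(\<Sum>j<n. real (Suc j) powr (e - 1)) \<le> C / e * real (Suc n) powr e" for n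
  proof -
    have "(\<Sum>j<n. real (Suc j) powr (e - 1))
        \<le> (\<Sum>j<n. C / e * (real (Suc (Suc j)) powr e - real (Suc j) powr e))"
      using C(2)[of "real (Suc _)"] by (intro sum_mono) (simp add: add.commute)
    also have "\<dots> = C / e * (real (Suc n) powr e - 1)"
      unfolding sum_distrib_left[symmetric]
      by (subst sum_lessThan_telescope[of "\<lambda>j. real (Suc j) powr e"]) simp
    also have "\<dots> \<le> C / e * real (Suc n) powr e"
      using C e by (intro mult_left_mono) auto
    finally show ?thesis .
  qed
  then show ?thesis using that[of "C / e"] C e by auto
qed

lemma sum_powr_tail_le:
  fixes e :: real
  assumes e: "e < 0"
  obtains C where "C > 0"
    "\<And>k n. (\<Sum>j\<in>{k..<n}. real (Suc j) powr (e - 1)) \<le> C * real (Suc k) powr e"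
proof -
  obtain C where C: "C > 0" "\<And>x. x \<ge> 1 \<Longrightarrow> x powr (e - 1) \<le> C * (((x + 1) powr e - x powr e) / e)"
    using powr_le_powr_difference[of e] e by auto
  define D where "D = C / (- e)"
  have D: "D > 0" using C e unfolding D_def by (intro divide_pos_pos) auto
  have "(\<Sum>j\<in>{k..<n}. real (Suc j) powr (e - 1)) \<le> D * real (Suc k) powr e" for k n
  proof (cases "k \<le> n")
    case True
    have "(\<Sum>j\<in>{k..<n}. real (Suc j) powr (e - 1))
        \<le> (\<Sum>j\<in>{k..<n}. D * (real (Suc j) powr e - real (Suc (Suc j)) powr e))"
    proof (rule sum_mono)
      fix j
      show "real (Suc j) powr (e - 1) \<le> D * (real (Suc j) powr e - real (Suc (Suc j)) powr e)"
        using C(2)[of "real (Suc j)"] e by (simp add: D_def add.commute field_simps)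
    qed
    also have "\<dots> = D * (real (Suc k) powr e - real (Suc n) powr e)"
      unfolding sum_distrib_left[symmetric]
      using sum_Suc_diff'[OF True, of "\<lambda>j. - (real (Suc j) powr e)"] by simp
    also have "\<dots> \<le> D * real (Suc k) powr e"
      using D by (intro mult_left_mono) auto
    finally show ?thesis .
  next
    case False
    then show ?thesis using D by simp
  qed
  then show ?thesis using that[of D] D by auto
qed

text \<open>
  The damping becomes effective below the index \<open>J = u powr (1 / \<beta>)\<close>. Up to \<open>J\<close> the summand
  is at most \<open>x powr (\<beta> - \<delta>) / u\<close> and beyond \<open>J\<close> at most \<open>x powr (- \<delta>)\<close>. The condition
  \<open>\<delta> < \<beta> + 1\<close> lets the last terms dominate the first sum, \<open>1 < \<delta>\<close> lets the first terms dominate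
  the second, so that both are of order \<open>J powr (1 - \<delta>)\<close>.
\<close>

lemma sum_powr_damped_le:
  fixes \<delta> \<beta> :: real
  assumes \<delta>: "1 < \<delta>" "\<delta> < \<beta> + 1"
  obtains C where "C > 0" "\<And>n u. u \<ge> 1 \<Longrightarrow>
    (\<Sum>j<n. real (Suc j) powr (- \<delta>) / (1 + u * real (Suc j) powr (- \<beta>))) \<le> C * u powr (- ((\<delta> - 1) / \<beta>))"
proof -
  have \<beta>: "\<beta> > 0" using \<delta> by simp
  obtain C1 where C1: "C1 > 0" "\<And>n. (\<Sum>j<n. real (Suc j) powr ((\<beta> - \<delta> + 1) - 1)) \<le> C1 * real (Suc n) powr (\<beta> - \<delta> + 1)"
    using sum_powr_le[of "\<beta> - \<delta> + 1"] \<delta> by auto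
  obtain C2 where C2: "C2 > 0" "\<And>k n. (\<Sum>j\<in>{k..<n}. real (Suc j) powr ((1 - \<delta>) - 1)) \<le> C2 * real (Suc k) powr (1 - \<delta>)"
    using sum_powr_tail_le[of "1 - \<delta>"] \<delta> by auto
  define C where "C = C1 * 2 powr (\<beta> - \<delta> + 1) + C2"
  have "(\<Sum>j<n. real (Suc j) powr (- \<delta>) / (1 + u * real (Suc j) powr (- \<beta>))) \<le> C * u powr (- ((\<delta> - 1) / \<beta>))"
    if u: "u \<ge> 1" for n u
  proof -
    define J where "J = u powr (1 / \<beta>)"
    define k where "k = nat \<lfloor>J\<rfloor>"
    have J1: "J \<ge> 1" using u \<beta> by (simp add: J_def ge_one_powr_ge_zero)
    have kJ: "real k \<le> J" "J \<le> real (Suc k)" using J1 unfolding k_def by linarith+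
    have uJ: "u = J powr \<beta>" using u \<beta> by (simp add: J_def powr_powr)
    define t where "t j = real (Suc j) powr (- \<delta>) / (1 + u * real (Suc j) powr (- \<beta>))" for j
    have t0: "t j \<ge> 0" for j using u by (simp add: t_def)
    have t1: "t j \<le> real (Suc j) powr ((\<beta> - \<delta> + 1) - 1) / u" for j
    proof -
      have "t j \<le> real (Suc j) powr (- \<delta>) / (u * real (Suc j) powr (- \<beta>))"
        using u unfolding t_def by (intro divide_left_mono) (auto intro!: mult_pos_pos add_pos_nonneg)
      also have "\<dots> = real (Suc j) powr ((\<beta> - \<delta> + 1) - 1) / u"
        using u by (simp add: powr_diff powr_minus field_simps)
      finally show ?thesis .
    qed
    have t2: "t j \<le> real (Suc j) powr ((1 - \<delta>) - 1)" for j
    proof -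
      have "t j \<le> real (Suc j) powr (- \<delta>) / 1"
        using u unfolding t_def by (intro divide_left_mono) (auto intro!: mult_pos_pos add_pos_nonneg)
      then show ?thesis by simp
    qed
    have "(\<Sum>j<n. t j) \<le> (\<Sum>j\<in>{..<k} \<union> {k..<n}. t j)"
      using t0 by (intro sum_mono2) auto
    also have "\<dots> = (\<Sum>j<k. t j) + (\<Sum>j\<in>{k..<n}. t j)"
      by (intro sum.union_disjoint) auto
    also have "(\<Sum>j<k. t j) \<le> (\<Sum>j<k. real (Suc j) powr ((\<beta> - \<delta> + 1) - 1)) / u"
      unfolding sum_divide_distrib by (intro sum_mono t1)
    also have "\<dots> \<le> C1 * real (Suc k) powr (\<beta> - \<delta> + 1) / u"
      using u C1(2)[of k] by (intro divide_right_mono) auto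
    also have "\<dots> \<le> C1 * (2 * J) powr (\<beta> - \<delta> + 1) / u"
      using u C1 \<delta> kJ J1 by (intro divide_right_mono mult_left_mono powr_mono2) auto
    also have "\<dots> = C1 * 2 powr (\<beta> - \<delta> + 1) * J powr (1 - \<delta>)"
      using J1 by (simp add: uJ powr_mult powr_diff powr_add field_simps)
    also have "(\<Sum>j\<in>{k..<n}. t j) \<le> (\<Sum>j\<in>{k..<n}. real (Suc j) powr ((1 - \<delta>) - 1))"
      by (intro sum_mono t2)
    also have "\<dots> \<le> C2 * real (Suc k) powr (1 - \<delta>)" by (rule C2)
    also have "\<dots> \<le> C2 * J powr (1 - \<delta>)"
      using C2 kJ J1 \<delta> by (intro mult_left_mono powr_mono2') auto
    also have "C1 * 2 powr (\<beta> - \<delta> + 1) * J powr (1 - \<delta>) + C2 * J powr (1 - \<delta>) = C * J powr (1 - \<delta>)"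
      by (simp add: C_def algebra_simps)
    also have "J powr (1 - \<delta>) = u powr (- ((\<delta> - 1) / \<beta>))"
      using \<beta> by (simp add: J_def powr_powr minus_divide_left)
    finally show ?thesis by (simp add: t_def)
  qed
  moreover have "C > 0" using C1 C2 by (simp add: C_def add_pos_pos)
  ultimately show ?thesis using that[of C] by blast
qed

section \<open>The contraction rate\<close>

text \<open>
  Two-sided bounds on the spectra are assumed for large indices only. As all the quantities are
  positive, a larger constant absorbs the finitely many exceptions.
\<close>

lemma eventually_le_imp_uniform_bound:
  fixes f g :: "nat \<Rightarrow> real"
  assumes g: "\<And>j. g j > 0" and ev: "\<forall>\<^sub>F j in sequentially. f j \<le> c * g j"
  obtains C where "C > 0" "\<And>j. f j \<le> C * g j"
proof -
  obtain k where k: "\<And>j. j \<ge> k \<Longrightarrow> f j \<le> c * g j"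
    using ev by (auto simp: eventually_sequentially)
  define C where "C = \<bar>c\<bar> + 1 + (\<Sum>i<k. \<bar>f i / g i\<bar>)"
  have S: "(\<Sum>i<k. \<bar>f i / g i\<bar>) \<ge> 0" by (simp add: sum_nonneg)
  have q: "f j / g j \<le> C" for j
  proof (cases "j < k")
    case True
    then have "\<bar>f j / g j\<bar> \<le> (\<Sum>i<k. \<bar>f i / g i\<bar>)"
      by (intro member_le_sum) auto
    then show ?thesis unfolding C_def by linarith
  next
    case False
    then have "f j / g j \<le> c" using k[of j] g[of j] by (simp add: field_simps)
    then show ?thesis using S by (simp add: C_def)
  qed
  have "f j \<le> C * g j" for j using q[of j] g[of j] by (simp add: field_simps)
  moreover have "C > 0" using S by (simp add: C_def)
  ultimately show ?thesis using that by blast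
qed

lemma Hs_antimono:
  assumes "r \<le> s" shows "Hs s \<subseteq> Hs r"
proof
  fix v assume "v \<in> Hs s"
  then have s: "summable (\<lambda>j. real (Suc j) powr (2 * s) * \<bar>v j\<bar>\<^sup>2)"
    by (simp add: Hs_def)
  have le: "norm (real (Suc j) powr (2 * r) * \<bar>v j\<bar>\<^sup>2) \<le> real (Suc j) powr (2 * s) * \<bar>v j\<bar>\<^sup>2" for j
    using assms by (simp add: abs_mult mult_right_mono powr_mono)
  show "v \<in> Hs r"
    using summable_comparison_test'[OF s, of 0, OF le] by (simp add: Hs_def)
qed

text \<open>
  The exponential tail is harmless because \<open>h \<le> 1\<close>: it decays faster than \<open>1 / (1 + N)\<close>, which
  is at most \<open>1 / (1 + N * h)\<close>. Hence \<open>K\<close> depends neither on the sample size nor, through \<open>a\<close>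
  and \<open>h\<close>, on the coordinate.
\<close>

lemma shrinkage_factor_le:
  fixes A c :: real
  assumes A: "A > 0" and c: "c > 0"
  obtains K where "K > 0"
    "\<And>N a h. 0 \<le> h \<Longrightarrow> h \<le> 1 \<Longrightarrow> A * h \<le> a \<Longrightarrow>
       1 / (1 + a * (c * real N)) + exp (- (c * real N)) \<le> K / (1 + real N * h)"
proof
  define A' where "A' = min 1 (A * c)"
  have A': "A' > 0" "A' \<le> 1" "A' \<le> A * c" using A c by (auto simp: A'_def)
  show "1 / A' + (1 + 1 / c) > 0" using A' c by (intro add_pos_pos) auto
  fix N :: nat and a h :: real
  assume h: "0 \<le> h" "h \<le> 1" and a: "A * h \<le> a"
  define z where "z = 1 + real N * h"
  have z: "z \<ge> 1" using h by (simp add: z_def)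
  have a0: "a \<ge> 0" using a h A mult_nonneg_nonneg[of A h] by linarith
  have le: "A' * z \<le> 1 + a * (c * real N)"
  proof -
    have "A' * (real N * h) \<le> (A * c) * (real N * h)"
      using A' h by (intro mult_right_mono) auto
    also have "\<dots> = (A * h) * (c * real N)" by simp
    also have "\<dots> \<le> a * (c * real N)" using a c by (intro mult_right_mono) auto
    finally show ?thesis using A' by (simp add: z_def distrib_left)
  qed
  have 1: "1 / (1 + a * (c * real N)) \<le> (1 / A') / z"
  proof -
    have "1 / (1 + a * (c * real N)) \<le> 1 / (A' * z)"
      using le A' z a0 c by (intro divide_left_mono) (auto intro!: mult_pos_pos add_pos_nonneg)
    then show ?thesis by simp
  qed
  have "z * exp (- (c * real N)) \<le> (1 + real N) * exp (- (c * real N))"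
    using h by (intro mult_right_mono) (auto simp: z_def mult_left_le)
  also have "\<dots> \<le> 1 + 1 / c"
  proof -
    have "1 \<le> exp (c * real N)" using c by simp
    moreover have "c * real N \<le> exp (c * real N)" using exp_ge_add_one_self[of "c * real N"] by linarith
    moreover have "real N = (c * real N) / c" using c by simp
    ultimately have "1 + real N \<le> exp (c * real N) + exp (c * real N) / c"
      using c by (metis add_mono divide_right_mono less_imp_le)
    then have "1 + real N \<le> (1 + 1 / c) * exp (c * real N)"
      by (simp add: distrib_right)
    then show ?thesis by (simp add: exp_minus field_simps)
  qed
  finally have 2: "exp (- (c * real N)) \<le> (1 + 1 / c) / z"
    using z by (simp add: field_simps)
  show "1 / (1 + a * (c * real N)) + exp (- (c * real N)) \<le> (1 / A' + (1 + 1 / c)) / (1 + real N * h)"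
    using 1 2 by (simp add: z_def[symmetric] add_divide_distrib)
qed

theorem theorem1p3:
  fixes \<phi> :: "nat \<Rightarrow> 'a::{real_inner, complete_space, second_countable_topology}"
    and Ldag :: "'a \<Rightarrow> 'a" and ldag :: "nat \<Rightarrow> real"
    and \<Lambda> :: "'a \<Rightarrow> 'a" and \<nu> :: "'a measure"
    and \<sigma> :: "nat \<Rightarrow> real"
    and \<gamma> s \<alpha> \<alpha>' p c1 c2 :: real
  assumes "orthonormal_basis \<phi>"
    and "\<gamma> > 0"
    and "diagonal_operator \<phi> ldag Ldag"
    and "ldag \<in> Hs s"
    and "covariance_operator \<phi> \<Lambda>"
    and "centered_gaussian_measure \<Lambda> \<nu>"
    and "c1 \<ge> 1" and "\<alpha> > 1/2"
    and "\<forall>\<^sub>F j in sequentially.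
           inverse c1 * real (Suc j) powr (-2 * \<alpha>) \<le> \<phi> j \<bullet> \<Lambda> (\<phi> j) \<and>
           \<phi> j \<bullet> \<Lambda> (\<phi> j) \<le> c1 * real (Suc j) powr (-2 * \<alpha>)"
    and "\<And>j. (\<sigma> j)\<^sup>2 > 0"
    and "c2 \<ge> 1"
    and "\<forall>\<^sub>F j in sequentially.
           inverse c2 * real (Suc j) powr (-2 * p) \<le> (\<sigma> j)\<^sup>2 \<and>
           (\<sigma> j)\<^sup>2 \<le> c2 * real (Suc j) powr (-2 * p)"
    and "0 \<le> \<alpha>'" and "\<alpha>' < \<alpha> + 1/2"
    and "min \<alpha> \<alpha>' + min (p - 1/2) s > 0"
  shows "\<exists>C>0. \<forall>\<^sub>F N in sequentially.
           (\<integral>\<^sup>+D. (\<integral>\<^sup>+l.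
               (\<Sum>j. ennreal (real (Suc j) powr (-2 * \<alpha>') * \<bar>ldag j - l j\<bar>\<^sup>2))
             \<partial>posterior \<phi> \<gamma> \<sigma> N D) \<partial>data_law \<phi> \<nu> \<gamma> ldag N)
           \<le> ennreal (C * real N powr (- ((\<alpha>' + min (p - 1/2) s) / (\<alpha> + p))))"
proof -
  note onb = assms(1) and \<gamma> = assms(2) and l = assms(4) and \<Lambda> = assms(5) and \<nu> = assms(6)
    and \<Lambda>_bounds = assms(9) and \<sigma>_pos = assms(10) and \<sigma>_bounds = assms(12)
  define x where "x j = real (Suc j)" for j
  have x1: "x j \<ge> 1" for j by (simp add: x_def)
  \<comment> \<open>The rate sees the truth only through the smoothness \<open>m\<close>: more than \<open>p - 1/2\<close> is not exploited.\<close>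
  define m where "m = min (p - 1/2) s"
  define \<beta> where "\<beta> = 2 * (\<alpha> + p)"
  define \<delta> where "\<delta> = 2 * (\<alpha>' + m)"
  have m: "m \<le> s" "m \<le> p - 1/2" by (auto simp: m_def)
  have "min \<alpha> \<alpha>' + m > 0" using assms(15) by (simp add: m_def)
  then have am: "\<alpha> + m > 0" "\<alpha>' + m > 0" by linarith+
  have \<beta>: "\<beta> > 0" using am m by (simp add: \<beta>_def)
  \<comment> \<open>Here \<open>\<alpha>' < \<alpha> + 1/2\<close> and \<open>m \<le> p - 1/2\<close> give \<open>\<alpha>' + m < \<alpha> + p\<close>.\<close>
  have \<delta>: "0 \<le> \<delta>" "\<delta> \<le> \<beta>" using am m assms(14) by (auto simp: \<delta>_def \<beta>_def)
  \<comment> \<open>The exponents of the variance term, in the range in which both halves of its sum are balanced.\<close>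
  have \<delta>2: "1 < 2 * (\<alpha>' + p)" "2 * (\<alpha>' + p) < \<beta> + 1"
    using am m assms(14) by (auto simp: \<beta>_def)

  define v where "v j = \<phi> j \<bullet> \<Lambda> (\<phi> j)" for j
  have "\<phi> j \<noteq> 0" for j
    using onb unfolding orthonormal_basis_def by (metis inner_zero_left zero_neq_one)
  then have v: "v j > 0" for j
    using \<Lambda> unfolding covariance_operator_def v_def by blast
  have \<nu>': "prob_space \<nu>" "sets \<nu> = sets borel"
    and g: "distr \<nu> borel (\<lambda>x. \<phi> j \<bullet> x) = gaussian 0 (v j)" for j
    using \<nu> by (auto simp: centered_gaussian_measure_def v_def)

  obtain V where V: "V > 0" "\<And>j. x j powr (-2 * \<alpha>) \<le> V * v j"
  proof (rule eventually_le_imp_uniform_bound[of v "\<lambda>j. x j powr (-2 * \<alpha>)" c1])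
    show "\<forall>\<^sub>F j in sequentially. x j powr (-2 * \<alpha>) \<le> c1 * v j"
      using \<Lambda>_bounds
    proof eventually_elim
      case (elim j)
      then show ?case using assms(7) by (simp add: x_def v_def field_simps)
    qed
  qed (use v in auto)
  obtain S where S: "S > 0" "\<And>j. x j powr (-2 * p) \<le> S * (\<sigma> j)\<^sup>2"
  proof (rule eventually_le_imp_uniform_bound[of "\<lambda>j. (\<sigma> j)\<^sup>2" "\<lambda>j. x j powr (-2 * p)" c2])
    show "\<forall>\<^sub>F j in sequentially. x j powr (-2 * p) \<le> c2 * (\<sigma> j)\<^sup>2"
      using \<sigma>_bounds
    proof eventually_elim
      case (elim j)
      then show ?case using assms(11) by (simp add: x_def field_simps)
    qed
  qed (use \<sigma>_pos in auto)
  obtain B where B: "B > 0" "\<And>j. (\<sigma> j)\<^sup>2 \<le> B * x j powr (-2 * p)"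
  proof (rule eventually_le_imp_uniform_bound[of "\<lambda>j. x j powr (-2 * p)" "\<lambda>j. (\<sigma> j)\<^sup>2" c2])
    show "\<forall>\<^sub>F j in sequentially. (\<sigma> j)\<^sup>2 \<le> c2 * x j powr (-2 * p)"
      using \<sigma>_bounds by eventually_elim (simp add: x_def)
  qed (auto simp: x_def)

  \<comment> \<open>The signal-to-noise ratio of one observation in coordinate \<open>j\<close>; it decays no faster than \<open>x j powr (- \<beta>)\<close>.\<close>
  define a where "a j = \<gamma> powi (-2) * (\<sigma> j)\<^sup>2 * v j" for j
  define A where "A = \<gamma> powi (-2) / (S * V)"
  have gp: "\<gamma> powi (-2) > 0" using \<gamma> by simp
  have A: "A > 0" using gp S V by (simp add: A_def)
  have aA: "A * x j powr (- \<beta>) \<le> a j" for j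
  proof -
    have "- \<beta> = -2 * p + -2 * \<alpha>" by (simp add: \<beta>_def)
    then have "x j powr (- \<beta>) = x j powr (-2 * p) * x j powr (-2 * \<alpha>)"
      by (simp only: powr_add)
    also have "\<dots> \<le> (S * (\<sigma> j)\<^sup>2) * (V * v j)"
      using S V by (intro mult_mono) auto
    finally have "A * x j powr (- \<beta>) \<le> A * ((S * (\<sigma> j)\<^sup>2) * (V * v j))"
      using A by (intro mult_left_mono) auto
    also have "\<dots> = a j" using S V by (simp add: A_def a_def)
    finally show ?thesis .
  qed
  have h: "0 \<le> x j powr (- \<beta>)" "x j powr (- \<beta>) \<le> 1" for j
    using x1[of j] \<beta> powr_mono[of "- \<beta>" 0 "x j"] by auto
  have c: "ln 3 / 4 > (0::real)" by simp
  obtain K where K: "K > 0" and "\<And>N a h. 0 \<le> h \<Longrightarrow> h \<le> 1 \<Longrightarrow> A * h \<le> a \<Longrightarrow>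
      1 / (1 + a * (ln 3 / 4 * real N)) + exp (- (ln 3 / 4 * real N)) \<le> K / (1 + real N * h)"
    using shrinkage_factor_le[OF A c] by blast
  then have K2: "1 / (1 + a j * (ln 3 / 4 * real N)) + exp (- (ln 3 / 4 * real N))
      \<le> K / (1 + real N * x j powr (- \<beta>))" for N j
    using h aA by blast

  define L where "L = (\<Sum>j. x j powr (2 * m) * (ldag j)\<^sup>2)"
  have "ldag \<in> Hs m" using l Hs_antimono[OF m(1)] by auto
  then have sL: "summable (\<lambda>j. x j powr (2 * m) * (ldag j)\<^sup>2)" by (simp add: Hs_def x_def)
  have L0: "L \<ge> 0" unfolding L_def by (intro suminf_nonneg sL) auto
  obtain C2 where C2: "C2 > 0" "\<And>n u. u \<ge> 1 \<Longrightarrow>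
    (\<Sum>j<n. x j powr (- (2 * (\<alpha>' + p))) / (1 + u * x j powr (- \<beta>))) \<le> C2 * u powr (- ((2 * (\<alpha>' + p) - 1) / \<beta>))"
    unfolding x_def using sum_powr_damped_le[OF \<delta>2] by blast
  define C where "C = K * L + 2 * K * B * C2"
  have C: "C > 0" using K L0 B C2 by (simp add: C_def add_nonneg_pos)
  have rate: "\<delta> / \<beta> = (\<alpha>' + min (p - 1/2) s) / (\<alpha> + p)"
    unfolding \<delta>_def \<beta>_def m_def by (rule mult_divide_mult_cancel_left) simp

  have "(\<integral>\<^sup>+D. (\<integral>\<^sup>+l. (\<Sum>j. ennreal (real (Suc j) powr (-2 * \<alpha>') * \<bar>ldag j - l j\<bar>\<^sup>2))
             \<partial>posterior \<phi> \<gamma> \<sigma> N D) \<partial>data_law \<phi> \<nu> \<gamma> ldag N)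
           \<le> ennreal (C * real N powr (- ((\<alpha>' + min (p - 1/2) s) / (\<alpha> + p))))"
    if N: "N \<ge> 1" for N
  proof -
    have u: "real N \<ge> 1" using N by simp
    define d where "d j = 1 + real N * x j powr (- \<beta>)" for j
    have d: "d j > 0" for j by (simp add: d_def add_pos_nonneg)
    define T where "T j = x j powr (-2 * \<alpha>') * ((ldag j)\<^sup>2 + 2 * (\<sigma> j)\<^sup>2)
        * (1 / (1 + a j * (ln 3 / 4 * real N)) + exp (- (ln 3 / 4 * real N)))" for j
    have a0: "a j \<ge> 0" for j using gp v[of j] by (simp add: a_def)
    have T0: "T j \<ge> 0" for j using a0[of j] by (simp add: T_def)
    have Tj: "T j \<le> K * real N powr (- \<delta> / \<beta>) * (x j powr (2 * m) * (ldag j)\<^sup>2)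
        + 2 * K * B * (x j powr (- (2 * (\<alpha>' + p))) / d j)" for j
    proof -
      have bias: "x j powr (-2 * \<alpha>') * (ldag j)\<^sup>2 / d j
          \<le> real N powr (- \<delta> / \<beta>) * (x j powr (2 * m) * (ldag j)\<^sup>2)"
      proof -
        have "x j powr (-2 * \<alpha>') * (ldag j)\<^sup>2 / d j
            = (x j powr (- \<delta>) / d j) * (x j powr (2 * m) * (ldag j)\<^sup>2)"
        proof -
          have "x j powr (-2 * \<alpha>') = x j powr (- \<delta>) * x j powr (2 * m)"
            by (simp add: \<delta>_def flip: powr_add)
          then show ?thesis by simp
        qed
        also have "\<dots> \<le> real N powr (- \<delta> / \<beta>) * (x j powr (2 * m) * (ldag j)\<^sup>2)"
          unfolding d_def using x1[of j] u \<delta> \<beta>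
          by (intro mult_right_mono powr_damped_le) auto
        finally show ?thesis .
      qed
      have var: "x j powr (-2 * \<alpha>') * (\<sigma> j)\<^sup>2 / d j \<le> B * (x j powr (- (2 * (\<alpha>' + p))) / d j)"
      proof -
        have "x j powr (-2 * \<alpha>') * (\<sigma> j)\<^sup>2 \<le> x j powr (-2 * \<alpha>') * (B * x j powr (-2 * p))"
          by (intro mult_left_mono B) auto
        also have "\<dots> = B * x j powr (- (2 * (\<alpha>' + p)))"
          by (simp add: algebra_simps flip: powr_add)
        finally show ?thesis using d[of j] by (simp add: divide_right_mono)
      qed
      have "T j \<le> x j powr (-2 * \<alpha>') * ((ldag j)\<^sup>2 + 2 * (\<sigma> j)\<^sup>2) * (K / d j)"
        unfolding T_def d_def by (intro mult_left_mono K2) auto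
      also have "\<dots> = K * (x j powr (-2 * \<alpha>') * (ldag j)\<^sup>2 / d j)
          + 2 * K * (x j powr (-2 * \<alpha>') * (\<sigma> j)\<^sup>2 / d j)"
        by (simp add: algebra_simps add_divide_distrib)
      also have "\<dots> \<le> K * (real N powr (- \<delta> / \<beta>) * (x j powr (2 * m) * (ldag j)\<^sup>2))
          + 2 * K * (B * (x j powr (- (2 * (\<alpha>' + p))) / d j))"
        using K by (intro add_mono mult_left_mono bias var) auto
      finally show ?thesis by (simp add: mult.assoc)
    qed
    have partial: "(\<Sum>j<n. T j) \<le> C * real N powr (- \<delta> / \<beta>)" for n
    proof -
      have "(\<Sum>j<n. T j) \<le> K * real N powr (- \<delta> / \<beta>) * (\<Sum>j<n. x j powr (2 * m) * (ldag j)\<^sup>2)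
          + 2 * K * B * (\<Sum>j<n. x j powr (- (2 * (\<alpha>' + p))) / d j)"
        unfolding sum_distrib_left sum.distrib[symmetric] by (intro sum_mono Tj)
      also have "\<dots> \<le> K * real N powr (- \<delta> / \<beta>) * L + 2 * K * B * (C2 * real N powr (- \<delta> / \<beta>))"
      proof (intro add_mono mult_left_mono)
        show "(\<Sum>j<n. x j powr (2 * m) * (ldag j)\<^sup>2) \<le> L"
          unfolding L_def by (intro sum_le_suminf sL) auto
        have "(\<Sum>j<n. x j powr (- (2 * (\<alpha>' + p))) / d j)
            \<le> C2 * real N powr (- ((2 * (\<alpha>' + p) - 1) / \<beta>))"
          unfolding d_def using u by (rule C2)
        \<comment> \<open>The variance term has the rate of the smoothness \<open>p - 1/2\<close>, which is at least \<open>m\<close>.\<close>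
        also have "\<dots> \<le> C2 * real N powr (- \<delta> / \<beta>)"
          using u \<beta> m C2(1) by (intro mult_left_mono powr_mono) (auto simp: \<delta>_def divide_simps)
        finally show "(\<Sum>j<n. x j powr (- (2 * (\<alpha>' + p))) / d j) \<le> C2 * real N powr (- \<delta> / \<beta>)" .
      qed (use K B in auto)
      finally show ?thesis by (simp add: C_def algebra_simps)
    qed
    have "(\<integral>\<^sup>+D. (\<integral>\<^sup>+l. (\<Sum>j. ennreal (x j powr (-2 * \<alpha>') * \<bar>ldag j - l j\<bar>\<^sup>2))
             \<partial>posterior \<phi> \<gamma> \<sigma> N D) \<partial>data_law \<phi> \<nu> \<gamma> ldag N) \<le> (\<Sum>j. ennreal (T j))"
      unfolding T_def a_def
      by (rule posterior_risk_le[OF \<gamma> N \<nu>' v g]) simp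
    also have "\<dots> \<le> ennreal (C * real N powr (- \<delta> / \<beta>))"
      using partial T0 by (intro suminf_le_const summableI) (simp add: sum_ennreal ennreal_leI)
    finally show ?thesis by (simp add: x_def rate)
  qed
  then show ?thesis
    using C by (intro exI[of _ C] conjI eventually_sequentiallyI[of 1]) auto
qed

end
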